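(* Let $SG$ be a signed intersection graph. Then the intersection polynomial $IP_{SG}(z)$ has a non-zero constant term if and only if $SG$ is positive (every vertex has sign $+$) and bipartite.
   Context: Ribbon graphs are finite, possibly non-orientable. For a ribbon graph $G$, let $v(G),e(G),f(G)$ be its numbers of vertices, edges and boundary components. For connected $G$ the Euler genus $\varepsilon(G)$ is defined by $2-\varepsilon(G)=v(G)-e(G)+f(G)$. For $A\subseteq E(G)$ the partial dual $G^{A}$ is obtained as follows: take the spanning ribbon subgraph $(V(G),A)$, glue a disc to $G$ along each boundary component of this subgraph (these discs are the vertex-discs of $G^A$), and remove the interiors of all vertex-discs of $G$; the edge-ribbons are kept as the edges of $G^A$. The partial-dual Euler genus polynomial of $G$ is ${}^{\partial}\varepsilon_{G}(z)=\sum_{A\subseteq E(G)}z^{\varepsilon(G^{A})}$. A bouquet is a ribbon graph with exactly one vertex. A loop $e$ at the vertex-disc $v$ is twisted if $e\cup v$ is homeomorphic to a Möbius band, and untwisted otherwise. The intersection graph $I(B)$ of a bouquet $B$ is the graph with vertex set $E(B)$ in which distinct $e$ and $f$ are adjacent if and only if their ends are met in the cyclic order $e\cdots f\cdots e\cdots f\cdots$ when travelling around the boundary of the unique vertex of $B$. The signed intersection graph $SI(B)$ is $I(B)$ together with a sign at each vertex: $+$ if the corresponding edge of $B$ is an untwisted loop, $-$ if it is a twisted loop. A graph $SG$ with a sign $+$ or $-$ at each vertex is called a signed intersection graph if $SG=SI(B)$ for some bouquet $B$. Its intersection polynomial is $IP_{SG}(z):={}^{\partial}\varepsilon_{B}(z)$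 for any bouquet $B$ with $SG=SI(B)$; this does not depend on the choice of $B$, since bouquets with the same signed intersection graph have the same partial-dual Euler genus polynomial. *)

theory Defs
  imports
    "HOL-Computational_Algebra.Polynomial"
    "HOL-Combinatorics.Permutations"
begin

section \<open>Ribbon graphs\<close>

text \<open>
  An edge-ribbon \<open>e\<close> is a rectangle with corners \<open>(e, a, b)\<close>. The bit \<open>a\<close> tells at which of the
  two ends of \<open>e\<close> (the arcs glued to vertex-discs) the corner lies, and \<open>b\<close> on which of its two
  free sides. The boundaries of the vertex-discs minus the edge-ends fall into arcs, each joining
  two corners; this gives a fixed-point-free involution of the corners. Conversely, edge-ends and
  arcs together form circles, and gluing a disc to each of them gives back the ribbon graph.
  Only the vertices without edges are invisible in the corners; they are counted separately.
  No orientation is involved, so non-orientable ribbon graphs are included.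
\<close>

type_synonym 'e corner = "'e \<times> bool \<times> bool"

record 'e ribbon_graph =
  edges :: "'e set"
  arc :: "'e corner \<Rightarrow> 'e corner"
  isolated :: nat

definition corners :: "'e ribbon_graph \<Rightarrow> 'e corner set" where
  "corners G = edges G \<times> UNIV"

definition ribbon_graph :: "'e ribbon_graph \<Rightarrow> bool" where
  "ribbon_graph G \<longleftrightarrow> finite (edges G) \<and> arc G permutes corners G \<and>
     (\<forall>x\<in>corners G. arc G x \<noteq> x \<and> arc G (arc G x) = x)"

fun across_end :: "'e corner \<Rightarrow> 'e corner" where
  "across_end (e, a, b) = (e, a, \<not> b)"

fun along_side :: "'e corner \<Rightarrow> 'e corner" where
  "along_side (e, a, b) = (e, \<not> a, b)"

text \<open>The circles composed of segments joining \<open>x\<close> to \<open>f x\<close> and \<open>x\<close> to \<open>g x\<close>, each given by the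
  set of corners on it.\<close>

definition circles :: "'a set \<Rightarrow> ('a \<Rightarrow> 'a) \<Rightarrow> ('a \<Rightarrow> 'a) \<Rightarrow> 'a set set" where
  "circles X f g = X // ({(x, f x) |x. x \<in> X} \<union> {(x, g x) |x. x \<in> X})\<^sup>*"

definition num_vertices :: "'e ribbon_graph \<Rightarrow> nat" where
  "num_vertices G = card (circles (corners G) across_end (arc G)) + isolated G"

definition num_edges :: "'e ribbon_graph \<Rightarrow> nat" where
  "num_edges G = card (edges G)"

text \<open>The number of boundary components of the spanning ribbon subgraph with edge set \<open>A\<close>: its
  boundary runs along the sides of the ribbons in \<open>A\<close> and, the other ribbons being deleted, along
  the parts of the vertex boundaries that were covered by their ends.\<close>

definition num_boundary_sub :: "'e ribbon_graph \<Rightarrow> 'e set \<Rightarrow> nat" where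
  "num_boundary_sub G A =
     card (circles (corners G) (\<lambda>x. if fst x \<in> A then along_side x else across_end x) (arc G))
       + isolated G"

definition num_boundary :: "'e ribbon_graph \<Rightarrow> nat" where
  "num_boundary G = num_boundary_sub G (edges G)"

text \<open>Meaningful for connected \<open>G\<close>.\<close>

definition euler_genus :: "'e ribbon_graph \<Rightarrow> int" where
  "euler_genus G = 2 - (int (num_vertices G) - int (num_edges G) + int (num_boundary G))"

section \<open>Partial duals\<close>

text \<open>
  The new vertex-discs are bounded by the boundary components of the spanning ribbon subgraph with
  edge set \<open>A\<close>. Hence the arcs stay the same, and a ribbon is now attached along its former sides
  if it is in \<open>A\<close>, and along its former ends otherwise. As the second component of a corner always
  refers to the ends, the corners of the ribbons in \<open>A\<close> are renamed.
\<close>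

fun swap_corner :: "'e set \<Rightarrow> 'e corner \<Rightarrow> 'e corner" where
  "swap_corner A (e, a, b) = (if e \<in> A then (e, b, a) else (e, a, b))"

definition partial_dual :: "'e ribbon_graph \<Rightarrow> 'e set \<Rightarrow> 'e ribbon_graph" where
  "partial_dual G A = G\<lparr>arc := swap_corner A \<circ> arc G \<circ> swap_corner A\<rparr>"

text \<open>The use of \<^const>\<open>nat\<close> loses nothing, as the Euler genus of a connected ribbon graph
  is nonnegative and partial duals of connected ribbon graphs are connected.\<close>

definition partial_dual_genus_poly :: "'e ribbon_graph \<Rightarrow> int poly" where
  "partial_dual_genus_poly G =
     (\<Sum>A\<in>Pow (edges G). monom 1 (nat (euler_genus (partial_dual G A))))"

lemma swap_corner_swap_corner [simp]: "swap_corner A (swap_corner A x) = x"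
  by (cases x) auto

lemma swap_corner_in_corners [simp]: "swap_corner A x \<in> corners G \<longleftrightarrow> x \<in> corners G"
  by (cases x) (auto simp: corners_def)

lemma ribbon_graph_partial_dual:
  assumes "ribbon_graph G"
  shows "ribbon_graph (partial_dual G A)"
proof -
  have *: "corners (partial_dual G A) = corners G"
    by (simp add: corners_def partial_dual_def)
  have perm: "arc G permutes corners G"
    using assms by (simp add: ribbon_graph_def)
  have arc: "arc G x \<noteq> x" "arc G (arc G x) = x" if "x \<in> corners G" for x
    using assms that by (simp_all add: ribbon_graph_def)
  have out: "arc G x = x" if "x \<notin> corners G" for x
    using perm that by (rule permutes_not_in)
  have inv: "arc G (arc G x) = x" for x
    using arc out by (cases "x \<in> corners G") simp_all
  let ?g = "swap_corner A \<circ> arc G \<circ> swap_corner A"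
  have gg: "?g (?g x) = x" for x
    by (simp add: inv)
  have g_out: "?g x = x" if "x \<notin> corners G" for x
    using that by (simp add: out)
  have "\<exists>!x. ?g x = y" for y
  proof (rule ex1I)
    show "?g (?g y) = y"
      by (rule gg)
    show "x = ?g y" if "?g x = y" for x
      using gg[of x] unfolding that by (rule sym)
  qed
  then have "?g permutes corners G"
    using g_out unfolding permutes_def by blast
  moreover have "?g x \<noteq> x" if "x \<in> corners G" for x
  proof
    assume "?g x = x"
    then have "arc G (swap_corner A x) = swap_corner A x"
      by (metis comp_apply swap_corner_swap_corner)
    with arc(1)[of "swap_corner A x"] that show False
      by simp
  qed
  moreover have "finite (edges G)"
    using assms by (simp add: ribbon_graph_def)
  moreover have "edges (partial_dual G A) = edges G" "arc (partial_dual G A) = ?g"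
    by (simp_all add: partial_dual_def)
  ultimately show ?thesis
    using gg unfolding ribbon_graph_def * by simp
qed

lemma card_circles_conj:
  assumes s: "\<And>x. s (s x) = x" and sX: "\<And>x. s x \<in> X \<longleftrightarrow> x \<in> X"
  shows "card (circles X (s \<circ> f \<circ> s) (s \<circ> g \<circ> s)) = card (circles X f g)"
proof -
  let ?R = "\<lambda>f g. {(x, f x) |x. x \<in> X} \<union> {(x, g x) |x. x \<in> X}"
  have step: "(s x, s y) \<in> (?R (s \<circ> f \<circ> s) (s \<circ> g \<circ> s))\<^sup>*" if "(x, y) \<in> (?R f g)\<^sup>*" for f g x y
    using that
  proof induction
    case (step y z)
    then have "(s y, s z) \<in> ?R (s \<circ> f \<circ> s) (s \<circ> g \<circ> s)"
      using s sX by auto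
    with step.IH show ?case
      by (rule rtrancl_into_rtrancl)
  qed simp
  have ss: "s \<circ> (s \<circ> h \<circ> s) \<circ> s = h" for h :: "'a \<Rightarrow> 'a"
    by (auto simp: s)
  have iff: "(s x, y) \<in> (?R (s \<circ> f \<circ> s) (s \<circ> g \<circ> s))\<^sup>* \<longleftrightarrow> (x, s y) \<in> (?R f g)\<^sup>*" for x y
    using step[of x "s y" f g] step[of "s x" y "s \<circ> f \<circ> s" "s \<circ> g \<circ> s"] unfolding ss s by blast
  have cls: "(?R (s \<circ> f \<circ> s) (s \<circ> g \<circ> s))\<^sup>* `` {s x} = s ` ((?R f g)\<^sup>* `` {x})" for x
  proof (intro set_eqI)
    fix y
    have "y \<in> s ` T \<longleftrightarrow> s y \<in> T" for T
      by (metis image_iff s)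
    then show "y \<in> (?R (s \<circ> f \<circ> s) (s \<circ> g \<circ> s))\<^sup>* `` {s x} \<longleftrightarrow> y \<in> s ` ((?R f g)\<^sup>* `` {x})"
      using iff[of x y] by (simp only: Image_singleton_iff)
  qed
  have X: "X = s ` X"
  proof
    show "X \<subseteq> s ` X"
      using s sX by (metis image_eqI subsetI)
    show "s ` X \<subseteq> X"
      using sX by blast
  qed
  have "circles X (s \<circ> f \<circ> s) (s \<circ> g \<circ> s) =
      (\<lambda>x. (?R (s \<circ> f \<circ> s) (s \<circ> g \<circ> s))\<^sup>* `` {x}) ` s ` X"
    unfolding circles_def quotient_def X[symmetric] by blast
  also have "\<dots> = (`) s ` (\<lambda>x. (?R f g)\<^sup>* `` {x}) ` X"
    by (simp only: image_image cls)
  also have "(\<lambda>x. (?R f g)\<^sup>* `` {x}) ` X = circles X f g"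
    unfolding circles_def quotient_def by blast
  finally have "circles X (s \<circ> f \<circ> s) (s \<circ> g \<circ> s) = (`) s ` circles X f g" .
  moreover have "inj_on ((`) s) (circles X f g)"
  proof (rule inj_on_inverseI)
    show "s ` s ` C = C" for C
      by (simp add: image_image s)
  qed
  ultimately show ?thesis
    by (simp add: card_image)
qed

lemma num_vertices_partial_dual: "num_vertices (partial_dual G A) = num_boundary_sub G A"
proof -
  let ?s = "swap_corner A" and ?h = "\<lambda>x. if fst x \<in> A then along_side x else across_end x"
  have "across_end = ?s \<circ> ?h \<circ> ?s"
    by (auto simp: fun_eq_iff)
  moreover have "corners (partial_dual G A) = corners G"
    by (simp add: corners_def partial_dual_def)
  moreover have "card (circles (corners G) (?s \<circ> ?h \<circ> ?s) (?s \<circ> arc G \<circ> ?s)) =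
      card (circles (corners G) ?h (arc G))"
    by (rule card_circles_conj) simp_all
  ultimately show ?thesis
    by (simp add: num_vertices_def num_boundary_sub_def partial_dual_def)
qed

section \<open>Bouquets and signed intersection graphs\<close>

definition bouquet :: "'e ribbon_graph \<Rightarrow> bool" where
  "bouquet B \<longleftrightarrow> ribbon_graph B \<and> num_vertices B = 1"

text \<open>The vertex-disc together with one loop is an annulus or a Moebius band, with two and one
  boundary components, respectively.\<close>

definition twisted :: "'e ribbon_graph \<Rightarrow> 'e \<Rightarrow> bool" where
  "twisted B e \<longleftrightarrow> num_boundary_sub B {e} = 1"

text \<open>Travelling around a vertex: from a corner to the other corner of the same edge-end, then
  along the arc to the next edge-end. In a bouquet, \<open>2 * num_edges B\<close> such steps go around the
  vertex exactly once and meet each of the edge-ends once.\<close>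

definition next_end :: "'e ribbon_graph \<Rightarrow> 'e corner \<Rightarrow> 'e corner" where
  "next_end B = arc B \<circ> across_end"

definition interlaced :: "'e ribbon_graph \<Rightarrow> 'e \<Rightarrow> 'e \<Rightarrow> bool" where
  "interlaced B e f \<longleftrightarrow> (\<exists>x\<in>corners B. \<exists>j k l. 0 < j \<and> j < k \<and> k < l \<and> l < 2 * num_edges B \<and>
     fst x = e \<and> fst ((next_end B ^^ j) x) = f \<and>
     fst ((next_end B ^^ k) x) = e \<and> fst ((next_end B ^^ l) x) = f)"

datatype sign = Positive | Negative

text \<open>In a signed graph, the map \<open>sg_sign\<close> is defined exactly on the vertices, so that equality of
  records is equality of signed graphs.\<close>

record 'v signed_graph =
  sg_verts :: "'v set"
  sg_edges :: "'v set set"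
  sg_sign :: "'v \<Rightarrow> sign option"

definition SI :: "'e ribbon_graph \<Rightarrow> 'e signed_graph" where
  "SI B = \<lparr>sg_verts = edges B,
     sg_edges = {{e, f} |e f. e \<in> edges B \<and> f \<in> edges B \<and> e \<noteq> f \<and> interlaced B e f},
     sg_sign = (\<lambda>e. if e \<in> edges B
                    then Some (if twisted B e then Negative else Positive) else None)\<rparr>"

definition signed_intersection_graph :: "'v signed_graph \<Rightarrow> bool" where
  "signed_intersection_graph S \<longleftrightarrow> (\<exists>B. bouquet B \<and> S = SI B)"

definition intersection_poly :: "'v signed_graph \<Rightarrow> int poly" where
  "intersection_poly S = partial_dual_genus_poly (SOME B. bouquet B \<and> S = SI B)"

definition positive :: "'v signed_graph \<Rightarrow> bool" where
  "positive S \<longleftrightarrow> (\<forall>v\<in>sg_verts S. sg_sign S v = Some Positive)"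

definition bipartite :: "'v signed_graph \<Rightarrow> bool" where
  "bipartite S \<longleftrightarrow> (\<exists>X Y. X \<union> Y = sg_verts S \<and> X \<inter> Y = {} \<and>
     (\<forall>E\<in>sg_edges S. \<exists>x\<in>X. \<exists>y\<in>Y. E = {x, y}))"

end

theory Submission
  imports Defs
begin

text \<open>
  Write \<open>f A\<close> for the number of boundary components of the spanning ribbon subgraph of a bouquet
  with edge set \<open>A\<close>, and \<open>n\<close> for the number of edges. The vertices of the partial dual are
  counted by \<open>f A\<close> and its boundary components by \<open>f (E - A)\<close>, so its Euler genus is
  \<open>2 + n - f A - f (E - A)\<close>. Adding an edge raises \<open>f\<close> by at most one, whence
  \<open>f A \<le> card A + 1\<close>, and the genus vanishes iff equality holds for both \<open>A\<close> and \<open>E - A\<close>.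
  Equality passes to subsets; as \<open>f {e} = 1\<close> for a twisted loop and \<open>f {e, f} = 1\<close> for two
  interlaced untwisted ones, it forces \<open>A\<close> to be untwisted and pairwise non-interlaced. Conversely,
  such an \<open>A\<close> has an innermost loop, whose two ends are joined by a stretch of the boundary of the
  vertex that meets no other end in \<open>A\<close>; adding this loop last splits off a circle.
\<close>

section \<open>Counting classes of equivalence relations\<close>

lemma equiv_UNIV_E:
  assumes "equiv UNIV E"
  shows "(x, x) \<in> E" "(x, y) \<in> E \<Longrightarrow> (y, x) \<in> E" "(x, y) \<in> E \<Longrightarrow> (y, z) \<in> E \<Longrightarrow> (x, z) \<in> E"
  using assms by (auto simp: equiv_def refl_on_def dest: symD transD)

lemma class_eq_iff:
  assumes "equiv UNIV E"
  shows "E `` {x} = E `` {y} \<longleftrightarrow> (x, y) \<in> E"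
  using equiv_class_eq_iff[OF assms] by simp

lemma quotient_conv_image: "X // E = (\<lambda>x. E `` {x}) ` X"
  by (auto simp: quotient_def)

lemma Image_class_coarser:
  assumes "equiv UNIV E" "equiv UNIV F" "E \<subseteq> F"
  shows "F `` (E `` {x}) = F `` {x}"
  using equiv_UNIV_E[OF assms(1)] equiv_UNIV_E[OF assms(2)] assms(3) by blast

text \<open>Every class of \<open>F\<close> is a union of classes of \<open>E\<close>, so passing to
  the \<open>F\<close>-closure maps the classes of \<open>E\<close> onto those of \<open>F\<close>.
  The bounds below compare cardinalities along this map.\<close>

lemma quotient_coarser:
  assumes "equiv UNIV E" "equiv UNIV F" "E \<subseteq> F"
  shows "X // F = (\<lambda>C. F `` C) ` (X // E)"
  by (simp add: quotient_conv_image image_image Image_class_coarser[OF assms])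

lemma card_quotient_coarser:
  assumes "equiv UNIV E" "equiv UNIV F" "E \<subseteq> F" "finite X"
  shows "card (X // F) \<le> card (X // E)"
  unfolding quotient_coarser[OF assms(1-3)]
  by (rule card_image_le) (simp add: quotient_conv_image assms(4))

text \<open>The map from \<open>E\<close>-classes onto \<open>F\<close>-classes sends the distinct
  classes of \<open>p\<close> and \<open>q\<close> to the same class; not being injective on a
  finite set, it has a smaller image.\<close>

lemma card_quotient_strictly_coarser:
  assumes E: "equiv UNIV E" and F: "equiv UNIV F" and "E \<subseteq> F" "finite X"
    and pq: "p \<in> X" "q \<in> X" "(p, q) \<in> F" "(p, q) \<notin> E"
  shows "card (X // F) < card (X // E)"
proof (rule ccontr)
  assume "\<not> card (X // F) < card (X // E)"
  then have "card ((\<lambda>C. F `` C) ` (X // E)) = card (X // E)"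
    using card_quotient_coarser[OF assms(1-4)] quotient_coarser[OF assms(1-3), of X] by simp
  then have "inj_on (\<lambda>C. F `` C) (X // E)"
    by (intro eq_card_imp_inj_on) (simp_all add: quotient_conv_image assms(4))
  moreover have "F `` (E `` {p}) = F `` (E `` {q})"
    using pq(3) by (simp add: Image_class_coarser[OF assms(1-3)] class_eq_iff[OF F])
  ultimately have "E `` {p} = E `` {q}"
    using pq(1,2) by (auto simp: quotient_conv_image dest: inj_onD)
  with pq(4) show False
    by (simp add: class_eq_iff[OF E])
qed

text \<open>By \<open>merge\<close>, \<open>F\<close> glues at most the classes of \<open>p\<close>
  and \<open>q\<close>. Leaving out the class of \<open>q\<close> makes the map of classes
  injective, so at most one class is lost.\<close>

lemma card_quotient_merge_two:
  assumes E: "equiv UNIV E" and F: "equiv UNIV F" and "E \<subseteq> F" "finite X"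
    and merge: "\<And>u v. (u, v) \<in> F \<Longrightarrow> (u, v) \<in> E \<or> (u \<in> E `` {p, q} \<and> v \<in> E `` {p, q})"
  shows "card (X // E) \<le> card (X // F) + 1"
proof -
  have "inj_on (\<lambda>C. F `` C) (X // E - {E `` {q}})"
  proof (rule inj_onI)
    fix C D
    assume C: "C \<in> X // E - {E `` {q}}" and D: "D \<in> X // E - {E `` {q}}" and eq: "F `` C = F `` D"
    obtain u v where uv: "C = E `` {u}" "D = E `` {v}"
      using C D by (auto simp: quotient_conv_image)
    have "(u, v) \<in> F"
      using eq by (simp add: uv Image_class_coarser[OF assms(1-3)] class_eq_iff[OF F])
    moreover have "(u, q) \<notin> E" "(v, q) \<notin> E"
      using C D by (auto simp: uv class_eq_iff[OF E])
    ultimately have "(u, v) \<in> E"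
      using merge equiv_UNIV_E[OF E] by blast
    then show "C = D"
      by (simp add: uv class_eq_iff[OF E])
  qed
  then have "card (X // E - {E `` {q}}) \<le> card (X // F)"
    by (rule card_inj_on_le)
      (auto simp: quotient_coarser[OF assms(1-3)], auto simp: quotient_conv_image assms(4))
  moreover have "card (X // E) \<le> card (X // E - {E `` {q}}) + 1"
    by (metis Suc_eq_plus1 card_Diff1_le card_Suc_Diff1 diff_le_self finite_imageI assms(4)
        quotient_conv_image le_SucI order_refl Diff_insert0 Diff_empty)
  ultimately show ?thesis
    by linarith
qed

section \<open>Circles as classes of an equivalence relation\<close>

definition side :: "'e set \<Rightarrow> 'e corner \<Rightarrow> 'e corner" where
  "side A x = (if fst x \<in> A then along_side x else across_end x)"

text \<open>The classes inside \<open>corners G\<close> are the circles counted for the spanning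
  subgraph with edges \<open>A\<close>. The closure also relates every other element to itself, so
  that for ribbon graphs this is an equivalence on \<open>UNIV\<close>.\<close>

definition conn :: "'e ribbon_graph \<Rightarrow> 'e set \<Rightarrow> ('e corner \<times> 'e corner) set" where
  "conn G A = ({(x, side A x) |x. x \<in> corners G} \<union> {(x, arc G x) |x. x \<in> corners G})\<^sup>*"

lemma num_boundary_sub_conn: "num_boundary_sub G A = card (corners G // conn G A) + isolated G"
  by (simp add: num_boundary_sub_def circles_def conn_def side_def)

lemma num_boundary_sub_empty: "num_boundary_sub G {} = num_vertices G"
proof -
  have "(\<lambda>x. if fst x \<in> {} then along_side x else across_end x) = across_end"
    by auto
  then show ?thesis
    unfolding num_boundary_sub_def num_vertices_def by (rule arg_cong[where f = "\<lambda>h. card (circles (corners G) h (arc G)) + isolated G"])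
qed

lemma fst_swap_corner [simp]: "fst (swap_corner A x) = fst x"
  by (cases x) simp

text \<open>Renaming by \<open>swap_corner A\<close> exchanges sides and ends of the ribbons in
  \<open>A\<close>. So the boundary of the dual runs in \<open>G\<close> across the ends of the
  ribbons in \<open>A\<close> and along the sides of all others.\<close>

lemma num_boundary_partial_dual:
  "num_boundary (partial_dual G A) = num_boundary_sub G (edges G - A)"
proof -
  let ?s = "swap_corner A" and ?X = "corners G"
  \<comment> \<open>Conjugating \<open>?h\<close> by \<open>?s\<close> gives
    \<open>along_side\<close> everywhere; on corners of \<open>G\<close>, \<open>- A\<close> agrees
    with \<open>edges G - A\<close>.\<close>
  let ?h = "\<lambda>x. if fst x \<in> - A then along_side x else across_end x"
  have r: "{(x, f x) |x. x \<in> ?X} = {(x, f' x) |x. x \<in> ?X}" if "\<And>x. x \<in> ?X \<Longrightarrow> f x = f' x"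
    for f f' :: "'a corner \<Rightarrow> 'a corner"
    using that by force
  have cong: "circles ?X f g = circles ?X f' g" if "\<And>x. x \<in> ?X \<Longrightarrow> f x = f' x"
    for f f' g :: "'a corner \<Rightarrow> 'a corner"
    unfolding circles_def using r[of f f'] that by presburger
  have "corners (partial_dual G A) = ?X"
    by (simp add: corners_def partial_dual_def)
  then have "num_boundary (partial_dual G A) = card (circles ?X
      (\<lambda>x. if fst x \<in> edges G then along_side x else across_end x) (?s \<circ> arc G \<circ> ?s)) + isolated G"
    by (simp add: num_boundary_def num_boundary_sub_def partial_dual_def)
  also have "circles ?X (\<lambda>x. if fst x \<in> edges G then along_side x else across_end x)
      (?s \<circ> arc G \<circ> ?s) = circles ?X (?s \<circ> ?h \<circ> ?s) (?s \<circ> arc G \<circ> ?s)"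
    by (rule cong) (auto simp: corners_def)
  also have "card \<dots> = card (circles ?X ?h (arc G))"
    by (rule card_circles_conj) simp_all
  also have "circles ?X ?h (arc G) =
      circles ?X (\<lambda>x. if fst x \<in> edges G - A then along_side x else across_end x) (arc G)"
    by (rule cong) (auto simp: corners_def)
  finally show ?thesis
    by (simp add: num_boundary_sub_def)
qed

lemma across_end_simps [simp]:
  "across_end (across_end x) = x" "fst (across_end x) = fst x"
  "fst (snd (across_end x)) = fst (snd x)" "across_end x \<in> corners G \<longleftrightarrow> x \<in> corners G"
  "across_end x \<noteq> x"
  by (cases x; auto simp: corners_def)+

lemma along_side_simps [simp]:
  "along_side (along_side x) = x" "fst (along_side x) = fst x"
  "along_side x \<in> corners G \<longleftrightarrow> x \<in> corners G" "fst (snd (along_side x)) \<longleftrightarrow> \<not> fst (snd x)"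
  by (cases x; auto simp: corners_def)+

lemma along_side_across_end: "along_side (across_end x) = across_end (along_side x)"
  by (cases x) auto

lemma side_simps [simp]:
  "side A (side A x) = x" "side A x \<in> corners G \<longleftrightarrow> x \<in> corners G"
  by (auto simp: side_def)

lemma same_end_cases:
  assumes "fst x = fst y" "fst (snd x) = fst (snd y)"
  shows "x = y \<or> x = across_end y"
  using assms by (cases x; cases y) auto

lemma ribbon_graph_arc:
  assumes "ribbon_graph G" "x \<in> corners G"
  shows "arc G x \<in> corners G" "arc G (arc G x) = x" "arc G x \<noteq> x"
  using assms by (auto simp: ribbon_graph_def permutes_in_image)

lemma finite_corners: "ribbon_graph G \<Longrightarrow> finite (corners G)"
  by (simp add: ribbon_graph_def corners_def)

lemma card_corners: "card (corners G) = 4 * card (edges G)"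
  by (simp add: corners_def card_cartesian_product flip: UNIV_Times_UNIV)

lemma equiv_conn:
  assumes "ribbon_graph G"
  shows "equiv UNIV (conn G A)"
proof -
  have "sym ({(x, side A x) |x. x \<in> corners G} \<union> {(x, arc G x) |x. x \<in> corners G})"
    using ribbon_graph_arc[OF assms] by (force simp: sym_def)
  then show ?thesis
    unfolding conn_def by (intro equivI sym_rtrancl trans_rtrancl refl_rtrancl) auto
qed

lemma conn_arc: "x \<in> corners G \<Longrightarrow> (x, arc G x) \<in> conn G A"
  and conn_side: "x \<in> corners G \<Longrightarrow> (x, side A x) \<in> conn G A"
  unfolding conn_def by (rule r_into_rtrancl; blast)+

lemma conn_least:
  assumes E: "equiv UNIV E"
    and "\<And>x. x \<in> corners G \<Longrightarrow> (x, arc G x) \<in> E" "\<And>x. x \<in> corners G \<Longrightarrow> (x, side A x) \<in> E"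
  shows "conn G A \<subseteq> E"
proof (rule subrelI)
  fix x y
  assume "(x, y) \<in> conn G A"
  then show "(x, y) \<in> E"
    unfolding conn_def
    by induction (use assms equiv_UNIV_E[OF E] in blast)+
qed

text \<open>The tool for showing that two corners lie on different circles, or that a set of corners
  exhausts a circle.\<close>

lemma conn_closed_set:
  assumes "(x, y) \<in> conn G A" "x \<in> S"
    and "\<And>x. x \<in> S \<Longrightarrow> x \<in> corners G \<Longrightarrow> arc G x \<in> S"
    and "\<And>x. x \<in> S \<Longrightarrow> x \<in> corners G \<Longrightarrow> side A x \<in> S"
  shows "y \<in> S"
  using assms(1,2) unfolding conn_def
  by induction (use assms(3,4) in blast)+

section \<open>Adding an edge\<close>

text \<open>In the subgraph with \<open>e\<close>, at most two circles run along sides of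
  \<open>e\<close>. Gluing them gives \<open>F\<close>, with at most one class less;
  \<open>F\<close> contains \<open>conn G A\<close>, which hence has at least as many classes as
  \<open>F\<close>.\<close>

lemma num_boundary_sub_insert_le:
  assumes G: "ribbon_graph G"
  shows "num_boundary_sub G (insert e A) \<le> num_boundary_sub G A + 1"
proof (cases "e \<in> A")
  case True
  then show ?thesis
    by (simp add: insert_absorb)
next
  case False
  let ?E = "conn G (insert e A)"
  \<comment> \<open>The two corners at one end of \<open>e\<close>. The sides of \<open>e\<close>
    lead from them to the corners at the other end, so the classes of \<open>p\<close> and
    \<open>q\<close> contain all four.\<close>
  define p q where "p = (e, False, False)" and "q = (e, False, True)"
  define S where "S = ?E `` {p, q}"
  define F where "F = ?E \<union> S \<times> S"
  note E = equiv_conn[OF G, of "insert e A"]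
  note EE = equiv_UNIV_E[OF E]
  have F: "equiv UNIV F"
  proof (rule equivI)
    show "refl F"
      using EE(1) by (auto simp: refl_on_def F_def)
    show "sym F"
      using EE(2) by (auto simp: sym_def F_def)
    have S: "y \<in> S" if "(x, y) \<in> ?E" "x \<in> S" for x y
      using that EE(3) unfolding S_def by blast
    show "trans F"
      using EE(2,3) S unfolding trans_def F_def by blast
  qed simp
  have "conn G A \<subseteq> F"
  proof (rule conn_least[OF F])
    show "(x, arc G x) \<in> F" if "x \<in> corners G" for x
      using conn_arc[OF that] by (simp add: F_def)
    show "(x, side A x) \<in> F" if x: "x \<in> corners G" for x
    proof (cases "fst x = e")
      case True
      then have p: "p \<in> corners G" "q \<in> corners G"
        using x by (auto simp: corners_def p_def q_def)
      have "side (insert e A) p \<in> S" "side (insert e A) q \<in> S" "p \<in> S" "q \<in> S"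
        using conn_side[OF p(1)] conn_side[OF p(2)] EE(1) unfolding S_def by blast+
      then have "(e, a, b) \<in> S" for a b
        by (cases a; cases b) (simp_all add: side_def p_def q_def)
      then have "y \<in> S" if "fst y = e" for y
        using that by (cases y) auto
      then have "x \<in> S" "side A x \<in> S"
        using True by (simp_all add: side_def)
      then show ?thesis
        by (simp add: F_def)
    next
      case False
      then have "side A x = side (insert e A) x"
        by (simp add: side_def)
      then show ?thesis
        using conn_side[OF x] by (simp add: F_def)
    qed
  qed
  then have "card (corners G // F) \<le> card (corners G // conn G A)"
    by (rule card_quotient_coarser[OF equiv_conn[OF G] F _ finite_corners[OF G]])
  moreover have "card (corners G // ?E) \<le> card (corners G // F) + 1"
    by (rule card_quotient_merge_two[OF E F _ finite_corners[OF G], of p q])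
      (auto simp: F_def S_def)
  ultimately show ?thesis
    by (simp add: num_boundary_sub_conn)
qed

lemma num_boundary_sub_union_le:
  assumes "ribbon_graph G" "finite C"
  shows "num_boundary_sub G (A \<union> C) \<le> num_boundary_sub G A + card C"
  using assms(2)
proof induction
  case (insert e C)
  then show ?case
    using num_boundary_sub_insert_le[OF assms(1), of e "A \<union> C"] by simp
qed simp

section \<open>Travelling around the vertex of a bouquet\<close>

lemma next_end_simps:
  assumes "ribbon_graph G" "x \<in> corners G"
  shows "next_end G x \<in> corners G" "arc G (across_end x) = next_end G x"
    "arc G (next_end G x) = across_end x"
  using ribbon_graph_arc[OF assms(1), of "across_end x"] assms(2) by (simp_all add: next_end_def)

lemma next_end_funpow_in_corners:
  assumes "ribbon_graph G" "x \<in> corners G"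
  shows "(next_end G ^^ i) x \<in> corners G"
  by (induction i) (simp_all add: assms next_end_simps)

lemma inj_next_end:
  assumes "ribbon_graph G"
  shows "inj (next_end G)"
proof -
  have "inj across_end"
    by (rule inj_on_inverseI[of _ across_end]) simp
  moreover have "inj (arc G)"
    using assms by (auto simp: ribbon_graph_def intro: permutes_inj)
  ultimately show ?thesis
    unfolding next_end_def by (rule inj_compose[rotated])
qed

text \<open>The walk never returns to its starting end in the opposite direction: removing the first
  and the last step from such a walk would give another one, shorter by two. The base cases hold as
  \<open>across_end\<close> and \<open>arc G\<close> fix no corner.\<close>

lemma next_end_funpow_neq_across_end:
  assumes G: "ribbon_graph G" and "x \<in> corners G"
  shows "(next_end G ^^ i) x \<noteq> across_end x"
  using assms(2)
proof (induction i arbitrary: x rule: induct_nat_012)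
  case 0
  then show ?case
    by (metis across_end_simps(5) funpow_0)
next
  case 1
  then show ?case
    using ribbon_graph_arc(3)[OF G, of "across_end x"] by (simp add: next_end_def)
next
  case (ge2 n)
  let ?y = "next_end G x"
  have y: "?y \<in> corners G"
    by (rule next_end_simps(1)[OF G ge2.prems])
  show ?case
  proof
    assume eq: "(next_end G ^^ Suc (Suc n)) x = across_end x"
    have z: "(next_end G ^^ n) ?y \<in> corners G"
      by (rule next_end_funpow_in_corners[OF G y])
    have "next_end G ((next_end G ^^ n) ?y) = across_end x"
      using eq by (simp add: funpow_swap1)
    then have "across_end ((next_end G ^^ n) ?y) = arc G (across_end x)"
      using next_end_simps(3)[OF G z] by simp
    then have "(next_end G ^^ n) ?y = across_end ?y"
      using next_end_simps(2)[OF G ge2.prems] by (metis across_end_simps(1))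
    with ge2.IH(1)[OF y] show False ..
  qed
qed

lemma next_end_funpow_neq_across_end_funpow:
  assumes "ribbon_graph G" "x \<in> corners G"
  shows "(next_end G ^^ i) x \<noteq> across_end ((next_end G ^^ j) x)"
proof (cases "j \<le> i")
  case True
  then have "(next_end G ^^ i) x = (next_end G ^^ (i - j)) ((next_end G ^^ j) x)"
    by (metis comp_apply funpow_add le_add_diff_inverse2)
  then show ?thesis
    using next_end_funpow_neq_across_end next_end_funpow_in_corners assms by metis
next
  case False
  then have "(next_end G ^^ j) x = (next_end G ^^ (j - i)) ((next_end G ^^ i) x)"
    by (metis comp_apply funpow_add le_add_diff_inverse2 nat_le_linear)
  then show ?thesis
    using next_end_funpow_neq_across_end next_end_funpow_in_corners assms across_end_simps(1)
    by metis
qed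

text \<open>At the end of a ribbon outside \<open>A\<close>, \<open>side A\<close> moves just as the
  walk does. The path starts at \<open>across_end x\<close> and stops before crossing the last end,
  so both outermost ends may belong to \<open>A\<close>.\<close>

lemma conn_across_end_next_end_funpow:
  assumes G: "ribbon_graph G" and x: "x \<in> corners G" and "0 < k"
    and "\<And>t. 0 < t \<Longrightarrow> t < k \<Longrightarrow> fst ((next_end G ^^ t) x) \<notin> A"
  shows "(across_end x, (next_end G ^^ k) x) \<in> conn G A"
  using assms(3,4)
proof (induction k rule: nat_induct_non_zero)
  case 1
  show ?case
    using conn_arc[of "across_end x" G A] x next_end_simps(2)[OF G x] by simp
next
  case (Suc k)
  let ?y = "(next_end G ^^ k) x"
  note y = next_end_funpow_in_corners[OF G x, of k]
  have "(across_end x, ?y) \<in> conn G A"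
    using Suc by simp
  moreover have "(?y, across_end ?y) \<in> conn G A"
    using conn_side[OF y, of A] Suc.prems[of k] Suc.hyps by (simp add: side_def)
  moreover have "(across_end ?y, next_end G ?y) \<in> conn G A"
    using conn_arc[of "across_end ?y" G A] y next_end_simps(2)[OF G y] by simp
  ultimately have "(across_end x, next_end G ?y) \<in> conn G A"
    using equiv_UNIV_E(3)[OF equiv_conn[OF G]] by blast
  then show ?case
    by simp
qed

lemma bouquet_conn:
  assumes "bouquet B" "x \<in> corners B" "y \<in> corners B"
  shows "(x, y) \<in> conn B {}"
proof -
  have G: "ribbon_graph B"
    using assms(1) by (simp add: bouquet_def)
  have "card (corners B // conn B {}) + isolated B = 1"
    using assms(1) by (simp add: bouquet_def num_boundary_sub_conn flip: num_boundary_sub_empty)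
  moreover have fin: "finite (corners B // conn B {})"
    by (simp add: quotient_conv_image finite_corners[OF G])
  ultimately have "card (corners B // conn B {}) \<le> Suc 0"
    by linarith
  then have "C = D" if "C \<in> corners B // conn B {}" "D \<in> corners B // conn B {}" for C D
    using card_le_Suc0_iff_eq[OF fin] that by blast
  then have "conn B {} `` {x} = conn B {} `` {y}"
    using assms(2,3) by (blast intro: quotientI)
  then show ?thesis
    by (simp add: class_eq_iff[OF equiv_conn[OF G]])
qed

text \<open>The orbit of \<open>x\<close> and its mirror image under \<open>across_end\<close> are
  disjoint and together closed under arcs and end crossings, so by \<open>bouquet_conn\<close> they
  exhaust the corners. The period \<open>p\<close> thus satisfies
  \<open>2 * p = 4 * n\<close>.\<close>

lemma bouquet_next_end_period:
  assumes B: "bouquet B" and x: "x \<in> corners B"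
  defines "n \<equiv> card (edges B)"
  shows "inj_on (\<lambda>i. (next_end B ^^ i) x) {..<2 * n}"
    and "corners B \<subseteq> (\<lambda>i. (next_end B ^^ i) x) ` {..<2 * n} \<union>
      across_end ` (\<lambda>i. (next_end B ^^ i) x) ` {..<2 * n}"
proof -
  have G: "ribbon_graph B"
    using B by (simp add: bouquet_def)
  let ?s = "\<lambda>i. (next_end B ^^ i) x"
  have s: "?s i \<in> corners B" for i
    by (rule next_end_funpow_in_corners[OF G x])
  have "finite {y. \<exists>n. y = ?s n}"
    by (rule finite_subset[OF _ finite_corners[OF G]]) (use s in auto)
  then have ex: "\<exists>p. 0 < p \<and> ?s p = x"
    using funpow_inj_finite[OF inj_next_end[OF G]] by metis
  define p where "p = (LEAST p. 0 < p \<and> ?s p = x)"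
  have p: "0 < p" "?s p = x"
    using LeastI_ex[OF ex] by (simp_all add: p_def)
  have least: "\<not> (0 < i \<and> ?s i = x)" if "i < p" for i
    using that unfolding p_def by (rule not_less_Least)
  have neq: "?s i \<noteq> ?s j" if "i < j" "j < p" for i j
  proof
    assume "?s i = ?s j"
    then have "(next_end B ^^ i) x = (next_end B ^^ i) (?s (j - i))"
      using that(1) by (metis comp_apply funpow_add le_add_diff_inverse less_imp_le)
    then have "x = ?s (j - i)"
      using inj_fn[OF inj_next_end[OF G]] by (auto dest: injD)
    then show False
      using least[of "j - i"] that by (metis diff_less_mono2 less_imp_diff_less zero_less_diff)
  qed
  have inj: "inj_on ?s {..<p}"
    by (rule linorder_inj_onI) (use neq in auto)
  let ?O = "?s ` {..<p}"
  let ?W = "?O \<union> across_end ` ?O"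
  have sO: "?s i \<in> ?O" if "i \<le> p" for i
  proof (cases "i = p")
    case True
    then have "?s i = ?s 0"
      by (simp add: p(2))
    then show ?thesis
      using p(1) by blast
  qed (use that in auto)
  have sub: "corners B \<subseteq> ?W"
  proof
    fix y
    assume "y \<in> corners B"
    then have "(x, y) \<in> conn B {}"
      by (rule bouquet_conn[OF B x])
    then show "y \<in> ?W"
    proof (rule conn_closed_set)
      have "?s 0 \<in> ?O"
        using p(1) by blast
      then show "x \<in> ?W"
        by simp
      fix z
      assume "z \<in> ?W"
      then consider i where "i < p" "z = ?s i" | i where "i < p" "z = across_end (?s i)"
        by blast
      note z = this
      show "side {} z \<in> ?W"
        using z by cases (auto simp: side_def)
      show "arc B z \<in> ?W"
        using z
      proof cases
        case 1
        \<comment> \<open>The predecessor of position 0 is position \<open>p - 1\<close>, since the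
          walk closes after \<open>p\<close> steps.\<close>
        obtain j where "j < p" "z = ?s (Suc j)"
        proof (cases i)
          case 0
          then show ?thesis
            using 1 p that[of "p - 1"] by simp
        next
          case (Suc j)
          then show ?thesis
            using 1 that[of j] by simp
        qed
        then have "j < p" "z = next_end B (?s j)"
          by simp_all
        then show ?thesis
          using next_end_simps(3)[OF G s[of j]] by auto
      next
        case 2
        then have "arc B z = ?s (Suc i)"
          using next_end_simps(2)[OF G s[of i]] by simp
        then show ?thesis
          using sO[of "Suc i"] 2 by simp
      qed
    qed
  qed
  moreover have "?W \<subseteq> corners B"
    using s by auto
  ultimately have W: "corners B = ?W"
    by blast
  have "?O \<inter> across_end ` ?O = {}"
    using next_end_funpow_neq_across_end_funpow[OF G x] by blast
  then have "card ?W = card ?O + card (across_end ` ?O)"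
    by (intro card_Un_disjoint) auto
  also have "card (across_end ` ?O) = card ?O"
    by (intro card_image inj_on_inverseI[of _ across_end]) simp
  also have "card ?O = p"
    using card_image[OF inj] by simp
  finally have "p = 2 * n"
    using card_corners[of B] W by (simp add: n_def)
  then show "inj_on ?s {..<2 * n}" "corners B \<subseteq> ?s ` {..<2 * n} \<union> across_end ` ?s ` {..<2 * n}"
    using inj sub by simp_all
qed

text \<open>Two visits to the same end would happen at the same corner, contradicting injectivity
  over one period, or at opposite corners, which would mean crossing the end in both
  directions.\<close>

lemma bouquet_visits_opposite_ends:
  assumes B: "bouquet B" and x: "x \<in> corners B"
    and "i < 2 * card (edges B)" "j < 2 * card (edges B)" "i \<noteq> j"
    and "fst ((next_end B ^^ i) x) = fst ((next_end B ^^ j) x)"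
  shows "fst (snd ((next_end B ^^ i) x)) \<noteq> fst (snd ((next_end B ^^ j) x))"
proof
  assume "fst (snd ((next_end B ^^ i) x)) = fst (snd ((next_end B ^^ j) x))"
  then have "(next_end B ^^ i) x = (next_end B ^^ j) x"
    using same_end_cases[OF assms(6)] next_end_funpow_neq_across_end_funpow[OF _ x] B
    by (auto simp: bouquet_def)
  then show False
    using inj_onD[OF bouquet_next_end_period(1)[OF B x]] assms(3-5) by auto
qed

text \<open>An edge has only two ends, and distinct visits are at distinct ends.\<close>

lemma bouquet_visits_edge_at_most_twice:
  assumes "bouquet B" "x \<in> corners B"
    and "i < 2 * card (edges B)" "j < 2 * card (edges B)" "k < 2 * card (edges B)"
    and "fst ((next_end B ^^ i) x) = fst ((next_end B ^^ j) x)"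
    and "fst ((next_end B ^^ k) x) = fst ((next_end B ^^ j) x)"
    and "i \<noteq> j" "k \<noteq> j"
  shows "k = i"
  using bouquet_visits_opposite_ends[OF assms(1,2,3,4)] bouquet_visits_opposite_ends[OF assms(1,2,5,4)]
    bouquet_visits_opposite_ends[OF assms(1,2,5,3)] assms(6-) by auto

lemma bouquet_visits_every_end:
  assumes "bouquet B" "x \<in> corners B" "e \<in> edges B"
  obtains i where "i < 2 * card (edges B)" "fst ((next_end B ^^ i) x) = e"
    "fst (snd ((next_end B ^^ i) x)) = a"
proof -
  \<comment> \<open>The side bit is arbitrary: one of the two corners of the end lies on the
    walk.\<close>
  have "(e, a, True) \<in> corners B"
    using assms(3) by (simp add: corners_def)
  then obtain i where "i < 2 * card (edges B)"
    "(e, a, True) = (next_end B ^^ i) x \<or> (e, a, True) = across_end ((next_end B ^^ i) x)"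
    using bouquet_next_end_period(2)[OF assms(1,2)] by blast
  then show ?thesis
    using that[of i] by (metis across_end_simps(2,3) fst_conv snd_conv)
qed

lemma bouquet_visits_other_end:
  assumes "bouquet B" "x \<in> corners B" "i < 2 * card (edges B)"
  obtains j where "j < 2 * card (edges B)" "j \<noteq> i"
    "fst ((next_end B ^^ j) x) = fst ((next_end B ^^ i) x)"
proof -
  have "fst ((next_end B ^^ i) x) \<in> edges B"
    using next_end_funpow_in_corners[of B x i] assms by (auto simp: bouquet_def corners_def)
  then show ?thesis
    using bouquet_visits_every_end[OF assms(1,2), of _ "\<not> fst (snd ((next_end B ^^ i) x))"] that
    by metis
qed

section \<open>Twisted and interlaced loops\<close>

text \<open>If the circles for \<open>A\<close> join the two corners of each end in
  \<open>A\<close>, then \<open>conn B {}\<close> is contained in \<open>conn B A\<close>, and the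
  bound is the number of vertices.\<close>

lemma num_boundary_sub_le_1I:
  assumes B: "bouquet B"
    and "\<And>x. x \<in> corners B \<Longrightarrow> fst x \<in> A \<Longrightarrow> (x, across_end x) \<in> conn B A"
  shows "num_boundary_sub B A \<le> 1"
proof -
  have G: "ribbon_graph B"
    using B by (simp add: bouquet_def)
  have "(x, side {} x) \<in> conn B A" if "x \<in> corners B" for x
    using assms(2)[OF that] conn_side[OF that, of A] by (auto simp: side_def split: if_splits)
  then have "conn B {} \<subseteq> conn B A"
    by (intro conn_least equiv_conn G conn_arc)
  then have "num_boundary_sub B A \<le> num_boundary_sub B {}"
    using card_quotient_coarser[OF equiv_conn[OF G] equiv_conn[OF G] _ finite_corners[OF G]]
    by (simp add: num_boundary_sub_conn)
  then show ?thesis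
    using B by (simp add: num_boundary_sub_empty bouquet_def)
qed

lemma num_boundary_sub_pos:
  assumes "ribbon_graph G" "corners G \<noteq> {}"
  shows "0 < num_boundary_sub G A"
  using assms finite_corners[OF assms(1)]
  by (simp add: num_boundary_sub_conn quotient_conv_image card_gt_0_iff)

text \<open>\<open>along_side\<close> takes the second visit to \<open>x\<close> or to
  \<open>across_end x\<close>. The former would make the loop twisted; the other equations follow
  from the latter.\<close>

lemma untwisted_along_side:
  assumes B: "bouquet B" and x: "x \<in> corners B" and "\<not> twisted B (fst x)"
    and "0 < m" "m < 2 * card (edges B)" and r: "fst ((next_end B ^^ m) x) = fst x"
  shows "along_side ((next_end B ^^ m) x) = across_end x"
    and "along_side (across_end x) = (next_end B ^^ m) x"
    and "along_side x = across_end ((next_end B ^^ m) x)"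
    and "along_side (across_end ((next_end B ^^ m) x)) = x"
proof -
  have G: "ribbon_graph B"
    using B by (simp add: bouquet_def)
  let ?r = "(next_end B ^^ m) x" and ?C = "conn B {fst x}"
  note EE = equiv_UNIV_E[OF equiv_conn[OF G, of "{fst x}"]]
  have rC: "?r \<in> corners B"
    by (rule next_end_funpow_in_corners[OF G x])
  have ends: "fst (snd ?r) \<noteq> fst (snd x)"
    using bouquet_visits_opposite_ends[OF B x, of m 0] assms(4,5) r by simp
  \<comment> \<open>The Moebius case: the stretch of vertex boundary between the visits and the two
    sides of the loop would link all four corners into one circle.\<close>
  have "along_side ?r \<noteq> x"
  proof
    assume eq: "along_side ?r = x"
    have path: "(across_end x, ?r) \<in> ?C"
    proof (rule conn_across_end_next_end_funpow[OF G x assms(4)])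
      fix t
      assume "0 < t" "t < m"
      then show "fst ((next_end B ^^ t) x) \<notin> {fst x}"
        using bouquet_visits_edge_at_most_twice[OF B x, of t 0 m] assms(4,5) r by auto
    qed
    have rx: "(?r, x) \<in> ?C"
      using conn_side[OF rC, of "{fst x}"] r eq by (simp add: side_def)
    have sq: "(across_end ?r, across_end x) \<in> ?C"
      using conn_side[of "across_end ?r" B "{fst x}"] rC r eq
      by (simp add: side_def along_side_across_end)
    have all: "(x, ?r) \<in> ?C" "(x, across_end x) \<in> ?C" "(x, across_end ?r) \<in> ?C"
    proof -
      show 1: "(x, ?r) \<in> ?C" by (rule EE(2)[OF rx])
      show 2: "(x, across_end x) \<in> ?C" by (rule EE(3)[OF 1 EE(2)[OF path]])
      show "(x, across_end ?r) \<in> ?C" by (rule EE(3)[OF 2 EE(2)[OF sq]])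
    qed
    have "num_boundary_sub B {fst x} \<le> 1"
    proof (rule num_boundary_sub_le_1I[OF B])
      fix y
      assume y: "y \<in> corners B" "fst y \<in> {fst x}"
      have "y \<in> {x, across_end x, ?r, across_end ?r}"
        using same_end_cases[of y x] same_end_cases[of y ?r] y(2) ends r by auto
      then have "(x, y) \<in> ?C \<and> (x, across_end y) \<in> ?C"
        using all EE(1)[of x] by (elim insertE) (simp_all only: across_end_simps, blast+)
      then show "(y, across_end y) \<in> ?C"
        using EE(2,3) by blast
    qed
    moreover have "0 < num_boundary_sub B {fst x}"
      using num_boundary_sub_pos[OF G] x by blast
    ultimately show False
      using assms(3) by (simp add: twisted_def)
  qed
  moreover have "along_side ?r = x \<or> along_side ?r = across_end x"
    by (rule same_end_cases) (use ends r in auto)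
  ultimately show "along_side ?r = across_end x"
    by blast
  then show "along_side (across_end x) = ?r" "along_side x = across_end ?r"
      "along_side (across_end ?r) = x"
    by (metis along_side_simps(1) along_side_across_end across_end_simps(1))+
qed

text \<open>From \<open>x\<close>, alternately along sides of the loops and stretches of the vertex
  boundary, one circle passes through all eight corners of the two loops; untwistedness determines
  where the sides lead.\<close>

lemma interlaced_num_boundary_sub:
  assumes B: "bouquet B" and "e \<noteq> f" "interlaced B e f" "\<not> twisted B e" "\<not> twisted B f"
  shows "num_boundary_sub B {e, f} \<le> 1"
proof -
  have G: "ribbon_graph B"
    using B by (simp add: bouquet_def)
  let ?n = "2 * card (edges B)"
  obtain x j k l where x: "x \<in> corners B"
    and o: "0 < j" "j < k" "k < l" "l < ?n"
    and xe: "fst x = e" and jf: "fst ((next_end B ^^ j) x) = f"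
    and ke: "fst ((next_end B ^^ k) x) = e" and lf: "fst ((next_end B ^^ l) x) = f"
    using assms(3) by (auto simp: interlaced_def num_edges_def)
  let ?s = "\<lambda>i. (next_end B ^^ i) x"
  have s: "?s i \<in> corners B" for i
    by (rule next_end_funpow_in_corners[OF G x])
  let ?C = "conn B {e, f}"
  note EE = equiv_UNIV_E[OF equiv_conn[OF G, of "{e, f}"]]
  have only: "t \<in> {0, j, k, l}" if "t < ?n" "fst (?s t) \<in> {e, f}" for t
    using bouquet_visits_edge_at_most_twice[OF B x, of k 0 t]
      bouquet_visits_edge_at_most_twice[OF B x, of l j t] that o xe jf ke lf by auto
  have path: "(across_end (?s a), ?s b) \<in> ?C"
    if "a < b" "b < ?n" "{a<..<b} \<inter> {0, j, k, l} = {}" for a b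
  proof -
    have add: "(next_end B ^^ t) (?s a) = ?s (t + a)" for t
      by (simp add: funpow_add)
    have "(across_end (?s a), (next_end B ^^ (b - a)) (?s a)) \<in> ?C"
    proof (rule conn_across_end_next_end_funpow[OF G s])
      fix t
      assume "0 < t" "t < b - a"
      then have "t + a \<in> {a<..<b}" "t + a < ?n"
        using that by auto
      then show "fst ((next_end B ^^ t) (?s a)) \<notin> {e, f}"
        using only[of "t + a"] that(3) unfolding add by blast
    qed (use that in simp)
    then show ?thesis
      using that(1) unfolding add by simp
  qed
  have p1: "(across_end x, ?s j) \<in> ?C"
    using path[of 0 j] o by auto
  have p2: "(across_end (?s j), ?s k) \<in> ?C"
    using path[of j k] o by auto
  have p3: "(across_end (?s k), ?s l) \<in> ?C"
    using path[of k l] o by auto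
  have al: "(y, along_side y) \<in> ?C" if "y \<in> corners B" "fst y \<in> {e, f}" for y
    using conn_side[OF that(1), of "{e, f}"] that(2) by (simp add: side_def)
  have ek: "along_side (?s k) = across_end x" "along_side x = across_end (?s k)"
    using untwisted_along_side(1,3)[OF B x, of k] assms(4) o xe ke by simp_all
  \<comment> \<open>Restarting the walk at position \<open>j\<close> puts the second visit to
    \<open>f\<close> at distance \<open>l - j\<close>.\<close>
  have "?s l = (next_end B ^^ (l - j)) (?s j)"
    using o by (simp flip: comp_apply[of "next_end B ^^ _"] funpow_add)
  then have fl: "along_side (?s l) = across_end (?s j)" "along_side (?s j) = across_end (?s l)"
    using untwisted_along_side(1,3)[OF B s, of j "l - j"] assms(5) o jf lf by simp_all
  have a1: "(?s k, across_end x) \<in> ?C"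
    using al[OF s, of k] ke ek by simp
  have a2: "(x, across_end (?s k)) \<in> ?C"
    using al[OF x] xe ek by simp
  have a3: "(?s l, across_end (?s j)) \<in> ?C"
    using al[OF s, of l] lf fl by simp
  have a4: "(?s j, across_end (?s l)) \<in> ?C"
    using al[OF s, of j] jf fl by simp
  have all: "(x, across_end (?s k)) \<in> ?C" "(x, ?s l) \<in> ?C" "(x, across_end (?s j)) \<in> ?C"
    "(x, ?s k) \<in> ?C" "(x, across_end x) \<in> ?C" "(x, ?s j) \<in> ?C" "(x, across_end (?s l)) \<in> ?C"
  proof -
    show 1: "(x, across_end (?s k)) \<in> ?C" by (rule a2)
    show 2: "(x, ?s l) \<in> ?C" by (rule EE(3)[OF 1 p3])
    show 3: "(x, across_end (?s j)) \<in> ?C" by (rule EE(3)[OF 2 a3])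
    show 4: "(x, ?s k) \<in> ?C" by (rule EE(3)[OF 3 p2])
    show 5: "(x, across_end x) \<in> ?C" by (rule EE(3)[OF 4 a1])
    show 6: "(x, ?s j) \<in> ?C" by (rule EE(3)[OF 5 p1])
    show "(x, across_end (?s l)) \<in> ?C" by (rule EE(3)[OF 6 a4])
  qed
  have ends: "fst (snd (?s k)) \<noteq> fst (snd x)" "fst (snd (?s l)) \<noteq> fst (snd (?s j))"
    using bouquet_visits_opposite_ends[OF B x, of k 0] bouquet_visits_opposite_ends[OF B x, of l j]
      o xe jf ke lf by simp_all
  show ?thesis
  proof (rule num_boundary_sub_le_1I[OF B])
    fix y
    assume y: "y \<in> corners B" "fst y \<in> {e, f}"
    have "y \<in> {x, across_end x, ?s k, across_end (?s k),
        ?s j, across_end (?s j), ?s l, across_end (?s l)}"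
    proof (cases "fst y = e")
      case True
      then show ?thesis
        using same_end_cases[of y x] same_end_cases[of y "?s k"] ends(1) xe ke by auto
    next
      case False
      then show ?thesis
        using same_end_cases[of y "?s j"] same_end_cases[of y "?s l"] ends(2) y(2) jf lf by auto
    qed
    then have "(x, y) \<in> ?C \<and> (x, across_end y) \<in> ?C"
      using all EE(1)[of x] by (elim insertE) (simp_all only: across_end_simps, blast+)
    then show "(y, across_end y) \<in> ?C"
      using EE(2,3) by blast
  qed
qed

text \<open>Without the loop, crossing its ends and following the free stretch between them joins
  its four corners, so adding the loop only refines the circles. Its side then closes the stretch
  into a circle that misses \<open>x\<close>, so the refinement is strict.\<close>

lemma num_boundary_sub_insert_innermost:
  assumes B: "bouquet B" and x: "x \<in> corners B" and "\<not> twisted B (fst x)"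
    and m: "0 < m" "m < 2 * card (edges B)" and r: "fst ((next_end B ^^ m) x) = fst x"
    and inner: "\<And>t. 0 < t \<Longrightarrow> t < m \<Longrightarrow> fst ((next_end B ^^ t) x) \<notin> A"
    and "fst x \<notin> A"
  shows "num_boundary_sub B A < num_boundary_sub B (insert (fst x) A)"
proof -
  have G: "ribbon_graph B"
    using B by (simp add: bouquet_def)
  let ?s = "\<lambda>i. (next_end B ^^ i) x"
  let ?C = "conn B A" and ?C' = "conn B (insert (fst x) A)"
  have s: "?s i \<in> corners B" for i
    by (rule next_end_funpow_in_corners[OF G x])
  note along = untwisted_along_side[OF B x assms(3) m r]
  note EE = equiv_UNIV_E[OF equiv_conn[OF G, of A]]
  have ends: "fst (snd (?s m)) \<noteq> fst (snd x)"
    using bouquet_visits_opposite_ends[OF B x, of m 0] m r by simp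
  have xq: "(x, across_end x) \<in> ?C"
    using conn_side[OF x, of A] assms(8) by (simp add: side_def)
  have rs: "(?s m, across_end (?s m)) \<in> ?C"
    using conn_side[OF s, of m A] assms(8) r by (simp add: side_def)
  have qr: "(across_end x, ?s m) \<in> ?C"
    by (rule conn_across_end_next_end_funpow[OF G x m(1) inner])
  have xr: "(x, ?s m) \<in> ?C"
    by (rule EE(3)[OF xq qr])
  have xs: "(x, across_end (?s m)) \<in> ?C"
    by (rule EE(3)[OF xr rs])
  have sub: "?C' \<subseteq> ?C"
  proof (rule conn_least[OF equiv_conn[OF G] conn_arc])
    fix y
    assume y: "y \<in> corners B"
    show "(y, side (insert (fst x) A) y) \<in> ?C"
    proof (cases "fst y = fst x")
      case True
      then have "y \<in> {x, across_end x, ?s m, across_end (?s m)}"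
        using same_end_cases[of y x] same_end_cases[of y "?s m"] ends r by auto
      moreover have "side (insert (fst x) A) y = along_side y"
        using True by (simp add: side_def)
      ultimately have "(x, y) \<in> ?C \<and> (x, side (insert (fst x) A) y) \<in> ?C"
        using xq xr xs EE(1)[of x] by (elim insertE) (simp_all only: along, blast+)
      then show ?thesis
        using EE(2,3) by blast
    next
      case False
      then have "side (insert (fst x) A) y = side A y"
        by (simp add: side_def)
      then show ?thesis
        using conn_side[OF y] by simp
    qed
  qed
  have "(across_end x, x) \<notin> ?C'"
  proof
    \<comment> \<open>The corners of the circle split off: the stretch from
      \<open>across_end x\<close> to the second visit \<open>?s m\<close>, without \<open>x\<close>
      and the far corner \<open>across_end (?s m)\<close>.\<close>
    define S where "S = (\<lambda>i. across_end (?s i)) ` {..<m} \<union> ?s ` {0<..m}"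
    assume "(across_end x, x) \<in> ?C'"
    then have "x \<in> S"
    proof (rule conn_closed_set)
      have "across_end (?s 0) \<in> S"
        using m(1) unfolding S_def by blast
      then show "across_end x \<in> S"
        by simp
      fix z
      assume "z \<in> S"
      then consider i where "i < m" "z = across_end (?s i)" | i where "0 < i" "i \<le> m" "z = ?s i"
        unfolding S_def by auto
      note z = this
      show "arc B z \<in> S"
        using z
      proof cases
        case 1
        then have "arc B z = ?s (Suc i)"
          using next_end_simps(2)[OF G s[of i]] by simp
        moreover have "Suc i \<in> {0<..m}"
          using 1 by simp
        ultimately show ?thesis
          unfolding S_def by blast
      next
        case 2
        then obtain j where "i = Suc j"
          by (cases i) auto
        then show ?thesis
          using 2 next_end_simps(3)[OF G s[of j]] by (auto simp: S_def)
      qed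
      show "side (insert (fst x) A) z \<in> S"
        using z
      proof cases
        case 1
        show ?thesis
        proof (cases "i = 0")
          \<comment> \<open>Here the circle closes: \<open>along_side\<close> joins the two
            extremities of the stretch.\<close>
          case True
          then show ?thesis
            using 1 along(2) m(1) by (auto simp: side_def S_def)
        next
          case False
          then have "fst (?s i) \<notin> insert (fst x) A"
            using bouquet_visits_edge_at_most_twice[OF B x, of i 0 m] inner[of i] 1 m r by auto
          then show ?thesis
            using 1 False by (auto simp: side_def S_def)
        qed
      next
        case 2
        show ?thesis
        proof (cases "i = m")
          case True
          have "across_end (?s 0) \<in> S"
            using m(1) unfolding S_def by blast
          then show ?thesis
            using 2 True along(1) r by (simp add: side_def)
        next
          case False
          then have "fst (?s i) \<notin> insert (fst x) A"
            using bouquet_visits_edge_at_most_twice[OF B x, of i 0 m] inner[of i] 2 m r by auto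
          then show ?thesis
            using 2 False by (auto simp: side_def S_def)
        qed
      qed
    qed
    then consider i where "x = across_end (?s i)" | i where "0 < i" "i \<le> m" "x = ?s i"
      unfolding S_def by auto
    then show False
    proof cases
      case 1
      then show False
        using next_end_funpow_neq_across_end_funpow[OF G x, of 0 i] by simp
    next
      case 2
      then show False
        using inj_onD[OF bouquet_next_end_period(1)[OF B x], of i 0] m by simp
    qed
  qed
  then have "card (corners B // ?C) < card (corners B // ?C')"
    using x xq EE(2)
    by (intro card_quotient_strictly_coarser[OF equiv_conn[OF G] equiv_conn[OF G] sub
          finite_corners[OF G], of "across_end x" x]) auto
  then show ?thesis
    by (simp add: num_boundary_sub_conn)
qed

text \<open>Take two visits to a loop of \<open>A\<close> at the smallest distance \<open>m\<close>.
  A loop of \<open>A\<close> visited in between has its other visit either also in between, at a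
  smaller distance, or beyond, and then the two loops are interlaced.\<close>

lemma innermost_loop:
  assumes B: "bouquet B" and A: "A \<subseteq> edges B" "A \<noteq> {}"
    and nonint: "\<And>e f. e \<in> A \<Longrightarrow> f \<in> A \<Longrightarrow> e \<noteq> f \<Longrightarrow> \<not> interlaced B e f"
  obtains x m where "x \<in> corners B" "fst x \<in> A" "0 < m" "m < 2 * card (edges B)"
    "fst ((next_end B ^^ m) x) = fst x"
    "\<forall>t\<in>{0<..<m}. fst ((next_end B ^^ t) x) \<notin> A"
proof -
  have G: "ribbon_graph B"
    using B by (simp add: bouquet_def)
  let ?n = "2 * card (edges B)"
  define P where "P m \<longleftrightarrow> 0 < m \<and> m < ?n \<and>
    (\<exists>x\<in>corners B. fst x \<in> A \<and> fst ((next_end B ^^ m) x) = fst x)" for m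
  obtain e where "e \<in> A"
    using A(2) by blast
  define y where "y = (e, True, True)"
  have y: "y \<in> corners B" "fst y \<in> A"
    using \<open>e \<in> A\<close> A(1) by (auto simp: y_def corners_def)
  have "0 < ?n"
    using \<open>e \<in> A\<close> A(1) G by (auto simp: ribbon_graph_def card_gt_0_iff)
  then obtain m0 where "m0 < ?n" "m0 \<noteq> 0" "fst ((next_end B ^^ m0) y) = fst ((next_end B ^^ 0) y)"
    by (rule bouquet_visits_other_end[OF B y(1)])
  then have "P m0"
    using y unfolding P_def by (intro conjI bexI[of _ y]) simp_all
  define m where "m = (LEAST m. P m)"
  have "P m"
    unfolding m_def by (rule LeastI) fact
  have least: "\<not> P i" if "i < m" for i
    using that unfolding m_def by (rule not_less_Least)
  obtain x where m: "0 < m" "m < ?n" and x: "x \<in> corners B" "fst x \<in> A"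
    and r: "fst ((next_end B ^^ m) x) = fst x"
    using \<open>P m\<close> by (auto simp: P_def)
  let ?s = "\<lambda>i. (next_end B ^^ i) x"
  have no_pair: False if "a < b" "b - a < m" "fst (?s a) \<in> A" "fst (?s b) = fst (?s a)" for a b
  proof -
    have "?s b = (next_end B ^^ (b - a)) (?s a)"
      using that(1) by (simp flip: comp_apply[of "next_end B ^^ _"] funpow_add)
    then have "P (b - a)"
      using that m next_end_funpow_in_corners[OF G x(1), of a] unfolding P_def
      by (intro conjI bexI[of _ "?s a"]) auto
    with least that(2) show False by blast
  qed
  have "fst (?s t) \<notin> A" if t: "0 < t" "t < m" for t
  proof
    assume A': "fst (?s t) \<in> A"
    have ne: "fst (?s t) \<noteq> fst x"
      using no_pair[of 0 t] t x by auto
    obtain l where l: "l < ?n" "l \<noteq> t" "fst (?s l) = fst (?s t)"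
      using bouquet_visits_other_end[OF B x(1), of t] t m by (metis less_trans)
    have "l \<noteq> 0"
      using l(3) ne by (metis funpow_0)
    moreover have "l \<noteq> m"
      using l(3) ne r by auto
    ultimately consider "l < t" | "t < l" "l < m" | "m < l"
      using l(2) by linarith
    then show False
    proof cases
      case 1
      moreover have "fst (?s l) \<in> A"
        using A' by (simp only: l(3))
      ultimately show False
        using no_pair[OF _ _ _ l(3)[symmetric]] t(2) by linarith
    next
      case 2
      then show False
        using no_pair[OF _ _ A' l(3)] by linarith
    next
      case 3
      then have "interlaced B (fst x) (fst (?s t))"
        using t l x(1) r unfolding interlaced_def num_edges_def
        by (intro bexI[of _ x] exI[of _ t] exI[of _ m] exI[of _ l]) auto
      then show False
        using nonint[OF x(2) A'] ne by auto
    qed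
  qed
  then show ?thesis
    using that[OF x m r] by simp
qed

section \<open>Edge sets with the maximal number of boundary components\<close>

lemma num_boundary_sub_bouquet_le:
  assumes "bouquet B" "finite A"
  shows "num_boundary_sub B A \<le> card A + 1"
  using num_boundary_sub_union_le[of B A "{}"] assms by (simp add: bouquet_def num_boundary_sub_empty)

text \<open>Remove an innermost loop and add it back last: by
  \<open>num_boundary_sub_insert_innermost\<close> it contributes a further circle.\<close>

lemma num_boundary_sub_noncrossing:
  assumes B: "bouquet B" and "finite A" and "A \<subseteq> edges B"
    and "\<And>e. e \<in> A \<Longrightarrow> \<not> twisted B e"
    and "\<And>e f. e \<in> A \<Longrightarrow> f \<in> A \<Longrightarrow> e \<noteq> f \<Longrightarrow> \<not> interlaced B e f"
  shows "card A + 1 \<le> num_boundary_sub B A"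
  using assms(2-)
proof (induction "card A" arbitrary: A)
  case 0
  then show ?case
    using B by (simp add: num_boundary_sub_empty bouquet_def)
next
  case (Suc n)
  then have "A \<noteq> {}"
    by auto
  obtain x m where x: "x \<in> corners B" "fst x \<in> A" and m: "0 < m" "m < 2 * card (edges B)"
    "fst ((next_end B ^^ m) x) = fst x"
    and inner: "\<forall>t\<in>{0<..<m}. fst ((next_end B ^^ t) x) \<notin> A"
    by (rule innermost_loop[OF B Suc.prems(2) \<open>A \<noteq> {}\<close> Suc.prems(4)])
  let ?A = "A - {fst x}"
  have card: "card A = card ?A + 1"
    using x(2) Suc.prems(1) by (metis Suc_eq_plus1 card_Suc_Diff1)
  have "card ?A + 1 \<le> num_boundary_sub B ?A"
    using Suc card by (intro Suc.hyps(1)) auto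
  also have "\<dots> < num_boundary_sub B (insert (fst x) ?A)"
    using inner Suc.prems(3)[OF x(2)]
    by (intro num_boundary_sub_insert_innermost[OF B x(1) _ m]) auto
  also have "insert (fst x) ?A = A"
    using x(2) by blast
  finally show ?case
    using card by simp
qed

lemma num_boundary_sub_maximal_iff:
  assumes B: "bouquet B" and A: "A \<subseteq> edges B"
  shows "num_boundary_sub B A = card A + 1 \<longleftrightarrow>
    (\<forall>e\<in>A. \<not> twisted B e) \<and> (\<forall>e\<in>A. \<forall>f\<in>A. e \<noteq> f \<longrightarrow> \<not> interlaced B e f)"
proof
  have G: "ribbon_graph B"
    using B by (simp add: bouquet_def)
  have fin: "finite A"
    using A G by (auto simp: ribbon_graph_def intro: finite_subset)
  {
    assume eq: "num_boundary_sub B A = card A + 1"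
    \<comment> \<open>Equality passes to subsets \<open>C\<close>, because the remaining edges
      contribute at most one circle each.\<close>
    have sub: "card C + 1 \<le> num_boundary_sub B C" if "C \<subseteq> A" for C
    proof -
      have "C \<union> (A - C) = A" "card A = card C + card (A - C)"
        using that fin by (auto simp: card_Diff_subset card_mono finite_subset)
      then show ?thesis
        using num_boundary_sub_union_le[OF G, of "A - C" C] fin eq by simp
    qed
    have tw: "\<not> twisted B e" if "e \<in> A" for e
      using sub[of "{e}"] that by (simp add: twisted_def)
    \<comment> \<open>Two interlaced untwisted loops leave at most one circle where three are
      required.\<close>
    moreover have "\<not> interlaced B e f" if "e \<in> A" "f \<in> A" "e \<noteq> f" for e f
      using sub[of "{e, f}"] that tw interlaced_num_boundary_sub[OF B that(3)] by force
    ultimately show "(\<forall>e\<in>A. \<not> twisted B e) \<and> (\<forall>e\<in>A. \<forall>f\<in>A. e \<noteq> f \<longrightarrow> \<not> interlaced B e f)"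
      by blast
  }
  assume "(\<forall>e\<in>A. \<not> twisted B e) \<and> (\<forall>e\<in>A. \<forall>f\<in>A. e \<noteq> f \<longrightarrow> \<not> interlaced B e f)"
  then show "num_boundary_sub B A = card A + 1"
    using num_boundary_sub_noncrossing[OF B fin A] num_boundary_sub_bouquet_le[OF B fin]
    by (intro antisym) auto
qed

section \<open>The constant term\<close>

lemma euler_genus_partial_dual:
  "euler_genus (partial_dual G A) =
    2 + int (card (edges G)) - int (num_boundary_sub G A) - int (num_boundary_sub G (edges G - A))"
  by (simp add: euler_genus_def num_vertices_partial_dual num_boundary_partial_dual num_edges_def)
    (simp add: partial_dual_def)

text \<open>Every subset contributes a monomial with coefficient 1, so nothing cancels. The
  inequality stems from \<open>nat\<close>, which sends all nonpositive genera to exponent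
  0.\<close>

lemma coeff_partial_dual_genus_poly_0:
  assumes "finite (edges G)"
  shows "coeff (partial_dual_genus_poly G) 0 \<noteq> 0 \<longleftrightarrow>
    (\<exists>A\<subseteq>edges G. euler_genus (partial_dual G A) \<le> 0)"
proof -
  have "coeff (partial_dual_genus_poly G) 0 =
      (\<Sum>A\<in>Pow (edges G). if euler_genus (partial_dual G A) \<le> 0 then 1 else 0)"
    by (simp add: partial_dual_genus_poly_def coeff_sum)
  then show ?thesis
    using assms by (auto simp: sum_nonneg_eq_0_iff split: if_splits)
qed

text \<open>The bounds for \<open>A\<close> and for its complement add up to
  \<open>2 + card (edges B)\<close>, so the genus is at most 0 exactly when both are
  attained.\<close>

lemma bouquet_euler_genus_partial_dual_le_0_iff:
  assumes B: "bouquet B" and A: "A \<subseteq> edges B"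
  shows "euler_genus (partial_dual B A) \<le> 0 \<longleftrightarrow>
    (\<forall>C\<in>{A, edges B - A}. (\<forall>e\<in>C. \<not> twisted B e) \<and>
      (\<forall>e\<in>C. \<forall>f\<in>C. e \<noteq> f \<longrightarrow> \<not> interlaced B e f))"
proof -
  have fin: "finite (edges B)" "finite A"
    using A B by (auto simp: bouquet_def ribbon_graph_def intro: finite_subset)
  have "card (edges B) = card A + card (edges B - A)"
    using A fin by (simp add: card_Diff_subset card_mono)
  then have "euler_genus (partial_dual B A) \<le> 0 \<longleftrightarrow>
      num_boundary_sub B A = card A + 1 \<and>
      num_boundary_sub B (edges B - A) = card (edges B - A) + 1"
    using num_boundary_sub_bouquet_le[OF B, of A] num_boundary_sub_bouquet_le[OF B, of "edges B - A"]
      fin unfolding euler_genus_partial_dual by force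
  then show ?thesis
    using num_boundary_sub_maximal_iff[OF B A] num_boundary_sub_maximal_iff[OF B, of "edges B - A"]
    by simp
qed

section \<open>Positivity and bipartiteness in terms of the loops\<close>

lemma positive_SI_iff: "positive (SI B) \<longleftrightarrow> (\<forall>e\<in>edges B. \<not> twisted B e)"
  by (auto simp: positive_def SI_def)

text \<open>One colour class \<open>A\<close> determines the other as its complement; all edges of
  the intersection graph run between them iff neither contains an interlaced pair.\<close>

lemma bipartite_SI_iff:
  "bipartite (SI B) \<longleftrightarrow> (\<exists>A\<subseteq>edges B. \<forall>C\<in>{A, edges B - A}.
    \<forall>e\<in>C. \<forall>f\<in>C. e \<noteq> f \<longrightarrow> \<not> interlaced B e f)" (is "_ \<longleftrightarrow> ?R")
proof
  assume "bipartite (SI B)"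
  then obtain X Y where XY: "X \<union> Y = edges B" "X \<inter> Y = {}"
    and E: "\<And>E. E \<in> sg_edges (SI B) \<Longrightarrow> \<exists>x\<in>X. \<exists>y\<in>Y. E = {x, y}"
    unfolding bipartite_def by (auto simp: SI_def)
  have "\<not> interlaced B e f" if "C = X \<or> C = Y" "e \<in> C" "f \<in> C" "e \<noteq> f" for C e f
  proof
    assume "interlaced B e f"
    then have "{e, f} \<in> sg_edges (SI B)"
      using that XY by (auto simp: SI_def)
    then obtain x y where "x \<in> X" "y \<in> Y" "{e, f} = {x, y}"
      using E by blast
    then show False
      using that XY by (auto simp: doubleton_eq_iff)
  qed
  moreover have "edges B - X = Y" "X \<subseteq> edges B"
    using XY by blast+
  ultimately show ?R
    by (intro exI[of _ X]) simp
next
  assume ?R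
  then obtain A where A: "A \<subseteq> edges B"
    and C: "\<forall>C\<in>{A, edges B - A}. \<forall>e\<in>C. \<forall>f\<in>C. e \<noteq> f \<longrightarrow> \<not> interlaced B e f"
    by metis
  have "\<exists>x\<in>A. \<exists>y\<in>edges B - A. E = {x, y}" if E: "E \<in> sg_edges (SI B)" for E
  proof -
    obtain e f where ef: "E = {e, f}" "e \<in> edges B" "f \<in> edges B" "e \<noteq> f" "interlaced B e f"
      using E by (auto simp: SI_def)
    then have "e \<in> A \<longleftrightarrow> f \<notin> A"
      using C by auto
    then show ?thesis
      using ef by (metis DiffI insert_commute)
  qed
  then show "bipartite (SI B)"
    using A unfolding bipartite_def
    by (intro exI[of _ A] exI[of _ "edges B - A"]) (auto simp: SI_def)
qed

theorem theorem17:
  fixes SG :: "'v signed_graph"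
  assumes "signed_intersection_graph SG"
  shows "coeff (intersection_poly SG) 0 \<noteq> 0 \<longleftrightarrow> positive SG \<and> bipartite SG"
proof -
  \<comment> \<open>The same choice as in \<open>intersection_poly\<close>, which therefore is the
    polynomial of this \<open>B\<close>.\<close>
  define B where "B = (SOME B. bouquet B \<and> SG = SI B)"
  have "bouquet B \<and> SG = SI B"
    using assms unfolding signed_intersection_graph_def B_def by (rule someI_ex)
  then have B: "bouquet B" and SG: "SG = SI B"
    by blast+
  have "finite (edges B)"
    using B by (simp add: bouquet_def ribbon_graph_def)
  then have "coeff (intersection_poly SG) 0 \<noteq> 0 \<longleftrightarrow>
      (\<exists>A\<subseteq>edges B. euler_genus (partial_dual B A) \<le> 0)"
    using coeff_partial_dual_genus_poly_0 by (simp add: intersection_poly_def B_def)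
  also have "\<dots> \<longleftrightarrow> positive SG \<and> bipartite SG"
  proof -
    \<comment> \<open>Untwistedness of \<open>A\<close> and of its complement together concerns all
      edges, independently of \<open>A\<close>. It can thus leave the existential quantifier and
      becomes positivity; what remains is bipartiteness.\<close>
    have "euler_genus (partial_dual B A) \<le> 0 \<longleftrightarrow> (\<forall>e\<in>edges B. \<not> twisted B e) \<and>
        (\<forall>C\<in>{A, edges B - A}. \<forall>e\<in>C. \<forall>f\<in>C. e \<noteq> f \<longrightarrow> \<not> interlaced B e f)"
      if A: "A \<subseteq> edges B" for A
    proof -
      have "(\<forall>e\<in>edges B. \<not> twisted B e) \<longleftrightarrow>
          (\<forall>e\<in>A. \<not> twisted B e) \<and> (\<forall>e\<in>edges B - A. \<not> twisted B e)"
        using A by blast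
      then show ?thesis
        unfolding bouquet_euler_genus_partial_dual_le_0_iff[OF B A] by simp argo
    qed
    then show ?thesis
      unfolding SG positive_SI_iff bipartite_SI_iff by (auto cong: conj_cong)
  qed
  finally show ?thesis .
qed

end
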